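(* Let $G$ be a group and $\mathcal{U}=\mathcal{U}(\mathbb{Z}[G])$. For all $i\ge 2$, $\mathcal{Z}_i(\mathcal{U})/\mathcal{Z}_{i-1}(\mathcal{U})$ is of finite exponent, provided that $\mathcal{Z}(G)$ is of finite exponent or $G$ is generated by torsion elements of bounded exponent.
   Context: $\mathcal{U}(\mathbb{Z}[G])$ is the group of units of the integral group ring $\mathbb{Z}[G]$; $\mathcal{Z}(G)$ is the center of $G$; $\mathcal{Z}_0(\mathcal{U})=\{1\}\le\mathcal{Z}_1(\mathcal{U})\le\mathcal{Z}_2(\mathcal{U})\le\cdots$ is the upper central series of $\mathcal{U}$ (so $\mathcal{Z}_1(\mathcal{U})$ is the center of $\mathcal{U}$). "$G$ is generated by torsion elements of bounded exponent" means that there are a generating set $X$ of $G$ and an integer $m\ge 1$ with $x^m=1$ for all $x\in X$. *)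

theory Defs
  imports "HOL-Algebra.Free_Abelian_Groups" "HOL-Algebra.Generated_Groups" "HOL-Algebra.Ring"
begin

text \<open>Elements of the integral group ring are finitely supported functions \<open>'a \<Rightarrow>\<^sub>0 int\<close> with support in
  the group; \<open>frag_extend\<close> is \<open>\<int>\<close>-linear extension, so the product is the bilinear extension of the
  group multiplication.\<close>

definition int_group_ring :: "('a, 'b) monoid_scheme \<Rightarrow> ('a \<Rightarrow>\<^sub>0 int) ring" where
  "int_group_ring G =
    \<lparr>carrier = {x. Poly_Mapping.keys x \<subseteq> carrier G},
     monoid.mult = (\<lambda>x y. frag_extend (\<lambda>g. frag_extend (\<lambda>h. frag_of (g \<otimes>\<^bsub>G\<^esub> h)) y) x),
     monoid.one = frag_of \<one>\<^bsub>G\<^esub>,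
     ring.zero = 0,
     ring.add = (+)\<rparr>"

abbreviation int_group_ring_units :: "('a, 'b) monoid_scheme \<Rightarrow> ('a \<Rightarrow>\<^sub>0 int) monoid" where
  "int_group_ring_units G \<equiv> units_of (int_group_ring G)"

definition group_center :: "('a, 'b) monoid_scheme \<Rightarrow> 'a set" where
  "group_center G = {z \<in> carrier G. \<forall>x \<in> carrier G. z \<otimes>\<^bsub>G\<^esub> x = x \<otimes>\<^bsub>G\<^esub> z}"

primrec upper_central :: "('a, 'b) monoid_scheme \<Rightarrow> nat \<Rightarrow> 'a set" where
  "upper_central G 0 = {\<one>\<^bsub>G\<^esub>}"
| "upper_central G (Suc n) =
    {x \<in> carrier G. upper_central G n #>\<^bsub>G\<^esub> x \<in> group_center (G Mod upper_central G n)}"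

definition finite_exponent :: "('a, 'b) monoid_scheme \<Rightarrow> bool" where
  "finite_exponent G \<longleftrightarrow> (\<exists>n::nat. n \<ge> 1 \<and> (\<forall>x \<in> carrier G. x [^]\<^bsub>G\<^esub> n = \<one>\<^bsub>G\<^esub>))"

definition bounded_torsion_generated :: "('a, 'b) monoid_scheme \<Rightarrow> bool" where
  "bounded_torsion_generated G \<longleftrightarrow>
    (\<exists>S. \<exists>m::nat. S \<subseteq> carrier G \<and> generate G S = carrier G \<and> m \<ge> 1 \<and>
      (\<forall>x \<in> S. x [^]\<^bsub>G\<^esub> m = \<one>\<^bsub>G\<^esub>))"

lemma frag_extend_cong':
  "(\<And>g. g \<in> Poly_Mapping.keys x \<Longrightarrow> f g = f' g) \<Longrightarrow> frag_extend f x = frag_extend f' x"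
  by (auto simp: frag_extend_def intro!: sum.cong)

lemma frag_extend_plus_fun:
  "frag_extend (\<lambda>g. f g + f' g) x = frag_extend f x + frag_extend f' x"
  by (simp add: frag_extend_def frag_cmul_distrib2 sum.distrib)

lemma frag_extend_frag_extend:
  "frag_extend f (frag_extend h x) = frag_extend (\<lambda>g. frag_extend f (h g)) x"
  by (simp add: frag_extend_def [of h] frag_extend_def [of "\<lambda>g. frag_extend f (h g)"]
      frag_extend_sum frag_extend_cmul o_def)

lemma ring_int_group_ring:
  assumes "group G"
  shows "ring (int_group_ring G)"
proof -
  interpret group G by (rule assms)
  show ?thesis
  proof (rule ringI)
    show "abelian_group (int_group_ring G)"
    proof (rule abelian_groupI)
      fix x y assume "x \<in> carrier (int_group_ring G)" "y \<in> carrier (int_group_ring G)"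
      then show "x \<oplus>\<^bsub>int_group_ring G\<^esub> y \<in> carrier (int_group_ring G)"
        using Poly_Mapping.keys_add[of x y] by (auto simp: int_group_ring_def)
    next
      fix x assume "x \<in> carrier (int_group_ring G)"
      then show "\<exists>y\<in>carrier (int_group_ring G). y \<oplus>\<^bsub>int_group_ring G\<^esub> x = \<zero>\<^bsub>int_group_ring G\<^esub>"
        by (intro bexI[of _ "- x"]) (auto simp: int_group_ring_def)
    qed (auto simp: int_group_ring_def algebra_simps)
    show "monoid (int_group_ring G)"
    proof (rule monoidI)
      fix x y assume "x \<in> carrier (int_group_ring G)" "y \<in> carrier (int_group_ring G)"
      then show "x \<otimes>\<^bsub>int_group_ring G\<^esub> y \<in> carrier (int_group_ring G)"
        by (auto simp: int_group_ring_def subset_iff dest!: subsetD[OF keys_frag_extend])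
    next
      fix x y z assume K: "x \<in> carrier (int_group_ring G)" "y \<in> carrier (int_group_ring G)"
        "z \<in> carrier (int_group_ring G)"
      then show "x \<otimes>\<^bsub>int_group_ring G\<^esub> y \<otimes>\<^bsub>int_group_ring G\<^esub> z =
          x \<otimes>\<^bsub>int_group_ring G\<^esub> (y \<otimes>\<^bsub>int_group_ring G\<^esub> z)"
        by (auto simp: int_group_ring_def frag_extend_frag_extend m_assoc subset_iff
            intro!: frag_extend_cong')
    next
      fix x assume K: "x \<in> carrier (int_group_ring G)"
      have "frag_extend (\<lambda>h. frag_of (\<one>\<^bsub>G\<^esub> \<otimes>\<^bsub>G\<^esub> h)) x = frag_extend frag_of x"
        using K by (intro frag_extend_cong') (auto simp: int_group_ring_def)
      then show "\<one>\<^bsub>int_group_ring G\<^esub> \<otimes>\<^bsub>int_group_ring G\<^esub> x = x"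
        by (simp add: int_group_ring_def frag_expansion[symmetric])
      have "frag_extend (\<lambda>h. frag_of (h \<otimes>\<^bsub>G\<^esub> \<one>\<^bsub>G\<^esub>)) x = frag_extend frag_of x"
        using K by (intro frag_extend_cong') (auto simp: int_group_ring_def)
      then show "x \<otimes>\<^bsub>int_group_ring G\<^esub> \<one>\<^bsub>int_group_ring G\<^esub> = x"
        by (simp add: int_group_ring_def frag_expansion[symmetric])
    qed (auto simp: int_group_ring_def)
  qed (auto simp: int_group_ring_def frag_extend_add frag_extend_plus_fun)
qed

lemma group_int_group_ring_units: "group G \<Longrightarrow> group (int_group_ring_units G)"
  using ring_int_group_ring monoid.units_group ring.is_monoid by blast

lemma normal_group_center:
  assumes "group G"
  shows "group_center G \<lhd> G"
proof -
  interpret group G by (rule assms)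
  have inv: "inv\<^bsub>G\<^esub> z \<otimes>\<^bsub>G\<^esub> x = x \<otimes>\<^bsub>G\<^esub> inv\<^bsub>G\<^esub> z" if "z \<in> group_center G" "x \<in> carrier G" for z x
    using that by (simp add: group_center_def inv_solve_left' inv_solve_right' m_assoc)
  show ?thesis
    unfolding normal_inv_iff
  proof
    show "subgroup (group_center G) G"
    proof
      show "inv\<^bsub>G\<^esub> z \<in> group_center G" if "z \<in> group_center G" for z
        using inv[OF that] that by (auto simp: group_center_def)
      fix y z assume yz: "y \<in> group_center G" "z \<in> group_center G"
      then have "y \<otimes>\<^bsub>G\<^esub> z \<otimes>\<^bsub>G\<^esub> x = x \<otimes>\<^bsub>G\<^esub> (y \<otimes>\<^bsub>G\<^esub> z)" if "x \<in> carrier G" for x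
        using that unfolding group_center_def by (smt (verit) m_assoc mem_Collect_eq)
      then show "y \<otimes>\<^bsub>G\<^esub> z \<in> group_center G"
        using yz m_closed unfolding group_center_def by blast
    qed (auto simp: group_center_def)
    show "\<forall>x\<in>carrier G. \<forall>z\<in>group_center G. x \<otimes>\<^bsub>G\<^esub> z \<otimes>\<^bsub>G\<^esub> inv\<^bsub>G\<^esub> x \<in> group_center G"
    proof (intro ballI)
      fix x z assume "x \<in> carrier G" "z \<in> group_center G"
      then have xz: "x \<otimes>\<^bsub>G\<^esub> z = z \<otimes>\<^bsub>G\<^esub> x" and "z \<in> carrier G"
        by (simp_all add: group_center_def)
      have "x \<otimes>\<^bsub>G\<^esub> z \<otimes>\<^bsub>G\<^esub> inv\<^bsub>G\<^esub> x = z \<otimes>\<^bsub>G\<^esub> x \<otimes>\<^bsub>G\<^esub> inv\<^bsub>G\<^esub> x"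
        by (simp only: xz)
      also have "\<dots> = z"
        using \<open>x \<in> carrier G\<close> \<open>z \<in> carrier G\<close> by (simp add: m_assoc)
      finally have "x \<otimes>\<^bsub>G\<^esub> z \<otimes>\<^bsub>G\<^esub> inv\<^bsub>G\<^esub> x = z" .
      with \<open>z \<in> group_center G\<close> show "x \<otimes>\<^bsub>G\<^esub> z \<otimes>\<^bsub>G\<^esub> inv\<^bsub>G\<^esub> x \<in> group_center G" by simp
    qed
  qed
qed

lemma normal_upper_central:
  assumes "group G"
  shows "upper_central G n \<lhd> G"
proof (induction n)
  case 0
  then show ?case using group.one_is_normal[OF assms] by simp
next
  case (Suc n)
  interpret N: normal "upper_central G n" G by (rule Suc)
  interpret Q: group "G Mod upper_central G n" by (rule N.factorgroup_is_group)
  let ?h = "\<lambda>x. upper_central G n #>\<^bsub>G\<^esub> x"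
  interpret h: group_hom G "G Mod upper_central G n" ?h
    by unfold_locales (rule N.r_coset_hom_Mod)
  interpret Z: normal "group_center (G Mod upper_central G n)" "G Mod upper_central G n"
    by (rule normal_group_center) unfold_locales
  show ?case
    unfolding N.normal_inv_iff
  proof
    show "subgroup (upper_central G (Suc n)) G"
    proof
      show "\<one>\<^bsub>G\<^esub> \<in> upper_central G (Suc n)"
        using Z.one_closed h.hom_one by simp
      show "inv\<^bsub>G\<^esub> x \<in> upper_central G (Suc n)" if "x \<in> upper_central G (Suc n)" for x
        using that Z.m_inv_closed h.hom_inv[of x] by simp
      show "x \<otimes>\<^bsub>G\<^esub> y \<in> upper_central G (Suc n)"
        if "x \<in> upper_central G (Suc n)" "y \<in> upper_central G (Suc n)" for x y
        using that Z.m_closed[of "?h x" "?h y"] h.hom_mult[of x y] by simp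
    qed simp
    show "\<forall>x\<in>carrier G. \<forall>z\<in>upper_central G (Suc n).
        x \<otimes>\<^bsub>G\<^esub> z \<otimes>\<^bsub>G\<^esub> inv\<^bsub>G\<^esub> x \<in> upper_central G (Suc n)"
    proof (intro ballI)
      fix x z assume xz: "x \<in> carrier G" "z \<in> upper_central G (Suc n)"
      then have z: "z \<in> carrier G" and hz: "?h z \<in> group_center (G Mod upper_central G n)"
        by simp_all
      have "?h (x \<otimes>\<^bsub>G\<^esub> z \<otimes>\<^bsub>G\<^esub> inv\<^bsub>G\<^esub> x) =
          ?h x \<otimes>\<^bsub>G Mod upper_central G n\<^esub> ?h z \<otimes>\<^bsub>G Mod upper_central G n\<^esub>
            inv\<^bsub>G Mod upper_central G n\<^esub> (?h x)"
        using xz(1) z h.hom_mult h.hom_inv N.m_closed N.inv_closed by metis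
      also have "\<dots> \<in> group_center (G Mod upper_central G n)"
        by (rule Z.inv_op_closed2[OF h.hom_closed[OF xz(1)] hz])
      finally show "x \<otimes>\<^bsub>G\<^esub> z \<otimes>\<^bsub>G\<^esub> inv\<^bsub>G\<^esub> x \<in> upper_central G (Suc n)"
        using xz(1) z by simp
    qed
  qed
qed

end

theory Submission
  imports Defs
begin

text \<open>The exponent of each factor of the upper central series divides that of the previous one, so
  only \<open>Z\<^sub>2/Z\<^sub>1\<close> matters. For \<open>u \<in> Z\<^sub>2\<close> and a group element \<open>g\<close>, the commutator \<open>c = [g, u]\<close> is a
  central unit with \<open>c\<^sup>k = [g\<^sup>k, u] = [g, u\<^sup>k]\<close>. If \<open>g\<^sup>m = 1\<close> this already shows that \<open>u\<^sup>m\<close> commutes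
  with \<open>g\<close>. In general, \<open>c\<^sup>k = [g\<^sup>k, u]\<close> shows that the powers of \<open>c\<close> are bounded in the
  \<open>\<ell>\<^sup>1\<close>-norm. But \<open>\<parallel>c\<^sup>2\<parallel>\<^sub>2 \<ge> \<parallel>c\<parallel>\<^sub>2\<^sup>2\<close> for central \<open>c\<close>, so the integer \<open>\<parallel>c\<parallel>\<^sub>2\<^sup>2\<close> must be 1. Hence \<open>c = \<plusminus>h\<close> with
  \<open>h \<in> Z(G)\<close>, and \<open>u\<^bsup>2n\<^esup>\<close> commutes with \<open>g\<close> when \<open>Z(G)\<close> has exponent \<open>n\<close>.\<close>

subsection \<open>Upper central series\<close>

lemma (in group) commutator_mult_eq:
  assumes "x \<in> carrier G" "y \<in> carrier G"
  shows "(y \<otimes> x \<otimes> inv y \<otimes> inv x) \<otimes> x \<otimes> y = y \<otimes> x"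
  using assms by (simp add: m_assoc)

text \<open>Each \<open>y\<close> that passes \<open>x\<close> leaves one factor \<open>c\<close>,
  and centrality lets these factors collect in front. With \<open>y\<close> a group element this
  both bounds the powers of \<open>c\<close> and, if \<open>y\<close> is torsion, kills one of
  them.\<close>

lemma (in group) commutator_nat_pow_left:
  assumes c: "c \<in> group_center G" and x: "x \<in> carrier G" and y: "y \<in> carrier G"
    and eq: "y \<otimes> x = c \<otimes> x \<otimes> y"
  shows "y [^] (k::nat) \<otimes> x = c [^] k \<otimes> x \<otimes> y [^] k"
proof (induction k)
  case (Suc k)
  have cc: "c \<in> carrier G" and comm: "\<And>a. a \<in> carrier G \<Longrightarrow> c \<otimes> a = a \<otimes> c"
    using c by (auto simp: group_center_def)
  have "y [^] Suc k \<otimes> x = y [^] k \<otimes> (c \<otimes> x \<otimes> y)"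
    using x y eq by (simp add: m_assoc)
  also have "\<dots> = y [^] k \<otimes> c \<otimes> (x \<otimes> y)"
    using x y cc by (simp add: m_assoc)
  also have "\<dots> = c \<otimes> (y [^] k \<otimes> x) \<otimes> y"
    using comm[of "y [^] k"] x y cc by (simp flip: m_assoc)
  also have "\<dots> = c \<otimes> c [^] k \<otimes> x \<otimes> y [^] Suc k"
    unfolding Suc using x y cc by (simp add: m_assoc)
  finally show ?case
    using comm[of "c [^] k"] cc by simp
qed (use x in simp)

text \<open>The same count with the power on the other argument; this form turns an exponent of
  \<open>c\<close> into a power of \<open>x\<close> that commutes with \<open>y\<close>.\<close>

lemma (in group) commutator_nat_pow_right:
  assumes c: "c \<in> group_center G" and x: "x \<in> carrier G" and y: "y \<in> carrier G"
    and eq: "y \<otimes> x = c \<otimes> x \<otimes> y"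
  shows "y \<otimes> x [^] (k::nat) = c [^] k \<otimes> x [^] k \<otimes> y"
proof (induction k)
  case (Suc k)
  have cc: "c \<in> carrier G" and comm: "\<And>a. a \<in> carrier G \<Longrightarrow> c \<otimes> a = a \<otimes> c"
    using c by (auto simp: group_center_def)
  have "y \<otimes> x [^] Suc k = (y \<otimes> x [^] k) \<otimes> x"
    using x y by (simp add: m_assoc)
  also have "\<dots> = c [^] k \<otimes> x [^] k \<otimes> (c \<otimes> x \<otimes> y)"
    unfolding Suc using x y cc eq by (simp add: m_assoc)
  also have "\<dots> = c [^] k \<otimes> (x [^] k \<otimes> c) \<otimes> (x \<otimes> y)"
    using x y cc by (simp add: m_assoc)
  also have "x [^] k \<otimes> c = c \<otimes> x [^] k"
    using comm[of "x [^] k"] x by simp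
  also have "c [^] k \<otimes> (c \<otimes> x [^] k) \<otimes> (x \<otimes> y) = c [^] Suc k \<otimes> x [^] Suc k \<otimes> y"
    using x y cc by (simp add: m_assoc)
  finally show ?case .
qed (use y in simp)

lemma (in group) commute_pow_if_commutator_pow_eq_one:
  assumes c: "c \<in> group_center G" and x: "x \<in> carrier G" and y: "y \<in> carrier G"
    and eq: "y \<otimes> x = c \<otimes> x \<otimes> y" and "c [^] (k::nat) = \<one>"
  shows "y \<otimes> x [^] k = x [^] k \<otimes> y"
  using commutator_nat_pow_right[OF c x y eq, of k] assms by simp

section \<open>Upper central series through commutators\<close>

context group
begin

text \<open>The cosets of \<open>x\<close> and \<open>y\<close> commute modulo N exactly when
  \<open>y \<otimes> x\<close> and \<open>x \<otimes> y\<close> differ by an element of N. This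
  replaces the definition by cosets with commutators.\<close>

lemma upper_central_Suc_iff:
  "x \<in> upper_central G (Suc n) \<longleftrightarrow>
    x \<in> carrier G \<and> (\<forall>y\<in>carrier G. y \<otimes> x \<otimes> inv y \<otimes> inv x \<in> upper_central G n)"
proof -
  interpret N: normal "upper_central G n" G
    by (rule normal_upper_central) (rule is_group)
  let ?N = "upper_central G n"
  have *: "?N #> x <#> (?N #> y) = ?N #> y <#> (?N #> x) \<longleftrightarrow>
      y \<otimes> x \<otimes> inv y \<otimes> inv x \<in> ?N" if "x \<in> carrier G" "y \<in> carrier G" for y
  proof -
    have "?N #> (y \<otimes> x) = ?N #> (x \<otimes> y) \<longleftrightarrow> y \<otimes> x \<in> ?N #> (x \<otimes> y)"
      using that N.subgroup_axioms
      by (metis m_closed repr_independence rcos_self)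
    also have "\<dots> \<longleftrightarrow> y \<otimes> x \<otimes> inv (x \<otimes> y) \<in> ?N"
      using that by (metis N.rcos_module m_closed is_group)
    also have "y \<otimes> x \<otimes> inv (x \<otimes> y) = y \<otimes> x \<otimes> inv y \<otimes> inv x"
      using that by (simp add: inv_mult_group m_assoc)
    finally show ?thesis using that by (auto simp: N.rcos_sum)
  qed
  show ?thesis
    using N.r_coset_hom_Mod
    by (simp add: group_center_def carrier_FactGroup * conj_ac hom_def Pi_iff cong: conj_cong)
qed

lemma upper_central_carrier: "x \<in> upper_central G n \<Longrightarrow> x \<in> carrier G"
  using normal_imp_subgroup[OF normal_upper_central[OF is_group]] subgroup.mem_carrier by metis

text \<open>By normality a conjugate of \<open>x\<close> stays in the subgroup, hence so does its
  product with the inverse of \<open>x\<close>.\<close>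

lemma upper_central_le_Suc: "upper_central G n \<subseteq> upper_central G (Suc n)"
proof -
  interpret N: normal "upper_central G n" G
    by (rule normal_upper_central) (rule is_group)
  show ?thesis
    using N.inv_op_closed2 by (auto simp: upper_central_Suc_iff simp del: upper_central.simps(2))
qed

lemma upper_central_1: "upper_central G (Suc 0) = group_center G"
proof -
  have "y \<otimes> x \<otimes> inv y \<otimes> inv x = \<one> \<longleftrightarrow> x \<otimes> y = y \<otimes> x"
    if "x \<in> carrier G" "y \<in> carrier G" for x y
    using that by (metis commutator_mult_eq inv_closed inv_mult_group inv_solve_right' l_one
        m_assoc m_closed r_inv)
  then show ?thesis
    by (auto simp: upper_central_Suc_iff group_center_def simp del: upper_central.simps(2))
qed

text \<open>This passes an exponent up the series. Modulo Z_n the commutator \<open>c\<close> of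
  \<open>y\<close> and \<open>x\<close> is central with trivial m-th power, so the commutator of
  \<open>y\<close> with the m-th power of \<open>x\<close> is trivial there as well.\<close>

lemma upper_central_pow_Suc:
  assumes m: "\<And>x. x \<in> upper_central G (Suc n) \<Longrightarrow> x [^] (m::nat) \<in> upper_central G n"
    and x: "x \<in> upper_central G (Suc (Suc n))"
  shows "x [^] m \<in> upper_central G (Suc n)"
proof -
  interpret N: normal "upper_central G n" G
    by (rule normal_upper_central) (rule is_group)
  let ?Q = "G Mod upper_central G n"
  interpret Q: group ?Q
    by (rule N.factorgroup_is_group)
  let ?h = "\<lambda>x. upper_central G n #> x"
  interpret h: group_hom G ?Q ?h
    by unfold_locales (rule N.r_coset_hom_Mod)
  have xG: "x \<in> carrier G"
    using x by simp
  have "?h (x [^] m) \<otimes>\<^bsub>?Q\<^esub> ?h y = ?h y \<otimes>\<^bsub>?Q\<^esub> ?h (x [^] m)" if y: "y \<in> carrier G" for y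
  proof -
    define c where "c = y \<otimes> x \<otimes> inv y \<otimes> inv x"
    have c: "c \<in> upper_central G (Suc n)"
      using x y unfolding c_def by (subst (asm) upper_central_Suc_iff) blast
    have cG: "c \<in> carrier G" and hc: "?h c \<in> group_center ?Q"
      using c by simp_all
    have "y \<otimes> x = c \<otimes> x \<otimes> y"
      using xG y by (simp add: c_def commutator_mult_eq)
    then have "?h y \<otimes>\<^bsub>?Q\<^esub> ?h x = ?h c \<otimes>\<^bsub>?Q\<^esub> ?h x \<otimes>\<^bsub>?Q\<^esub> ?h y"
      using cG xG y by (metis h.hom_mult m_closed)
    then have "?h y \<otimes>\<^bsub>?Q\<^esub> ?h x [^]\<^bsub>?Q\<^esub> m = ?h c [^]\<^bsub>?Q\<^esub> m \<otimes>\<^bsub>?Q\<^esub> ?h x [^]\<^bsub>?Q\<^esub> m \<otimes>\<^bsub>?Q\<^esub> ?h y"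
      by (intro Q.commutator_nat_pow_right hc h.hom_closed xG y)
    moreover have "?h c [^]\<^bsub>?Q\<^esub> m = \<one>\<^bsub>?Q\<^esub>"
      using m[OF c] cG by (simp add: N.FactGroup_pow N.rcos_const)
    ultimately show ?thesis
      using xG y by (metis Q.l_one Q.nat_pow_closed h.hom_closed h.hom_nat_pow)
  qed
  then show ?thesis
    using xG by (auto simp: group_center_def carrier_FactGroup)
qed

lemma finite_exponent_quotient:
  assumes H: "subgroup H G" and N: "N \<lhd> G" "N \<subseteq> H"
    and m: "m \<ge> 1" and pow: "\<And>x. x \<in> H \<Longrightarrow> x [^] (m::nat) \<in> N"
  shows "finite_exponent (G\<lparr>carrier := H\<rparr> Mod N)"
proof -
  interpret NH: normal N "G\<lparr>carrier := H\<rparr>"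
    by (rule normal_restrict_supergroup[OF H N])
  have "(N #>\<^bsub>G\<lparr>carrier := H\<rparr>\<^esub> x) [^]\<^bsub>G\<lparr>carrier := H\<rparr> Mod N\<^esub> m = N" if "x \<in> H" for x
    using that pow[of x] NH.FactGroup_pow[of x m] NH.rcos_const[OF NH.is_group, of "x [^] m"]
      nat_pow_consistent[of x m H]
    by simp
  then show ?thesis
    unfolding finite_exponent_def using m
    by (intro exI[of _ m]) (simp add: carrier_FactGroup)
qed

end

subsection \<open>Norms and involution on the integral group ring\<close>

definition l1_norm :: "('a \<Rightarrow>\<^sub>0 int) \<Rightarrow> int" where
  "l1_norm x = (\<Sum>g\<in>Poly_Mapping.keys x. \<bar>Poly_Mapping.lookup x g\<bar>)"

text \<open>Keeping the square makes this an integer: a positive value other than 1 is at least 2,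
  which starts the growth argument for central units.\<close>

definition l2_norm_sq :: "('a \<Rightarrow>\<^sub>0 int) \<Rightarrow> int" where
  "l2_norm_sq x = (\<Sum>g\<in>Poly_Mapping.keys x. (Poly_Mapping.lookup x g)\<^sup>2)"

text \<open>The classical involution of the group ring, whose product with the original element
  exposes the l2 norm as the coefficient at the identity.\<close>

definition frag_star :: "('a, 'b) monoid_scheme \<Rightarrow> ('a \<Rightarrow>\<^sub>0 int) \<Rightarrow> 'a \<Rightarrow>\<^sub>0 int" where
  "frag_star G = frag_extend (\<lambda>g. frag_of (inv\<^bsub>G\<^esub> g))"

lemma l1_norm_superset:
  assumes "finite A" "Poly_Mapping.keys x \<subseteq> A"
  shows "l1_norm x = (\<Sum>g\<in>A. \<bar>Poly_Mapping.lookup x g\<bar>)"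
  unfolding l1_norm_def using assms by (intro sum.mono_neutral_left) (auto simp: in_keys_iff)

lemma l1_norm_nonneg: "0 \<le> l1_norm x"
  by (simp add: l1_norm_def sum_nonneg)

lemma l1_norm_frag_of [simp]: "l1_norm (frag_of g) = 1"
  by (simp add: l1_norm_def keys_frag_of)

lemma l1_norm_add_le: "l1_norm (x + y) \<le> l1_norm x + l1_norm y"
proof -
  let ?A = "Poly_Mapping.keys x \<union> Poly_Mapping.keys y"
  have "l1_norm (x + y) = (\<Sum>g\<in>?A. \<bar>Poly_Mapping.lookup x g + Poly_Mapping.lookup y g\<bar>)"
    by (subst l1_norm_superset[of ?A])
      (auto simp: lookup_add dest!: subsetD[OF Poly_Mapping.keys_add])
  also have "\<dots> \<le> (\<Sum>g\<in>?A. \<bar>Poly_Mapping.lookup x g\<bar> + \<bar>Poly_Mapping.lookup y g\<bar>)"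
    by (intro sum_mono) simp
  also have "\<dots> = l1_norm x + l1_norm y"
    by (simp add: sum.distrib l1_norm_superset[of ?A])
  finally show ?thesis .
qed

lemma l1_norm_frag_cmul: "l1_norm (frag_cmul c x) = \<bar>c\<bar> * l1_norm x"
  by (subst l1_norm_superset[of "Poly_Mapping.keys x"])
    (auto simp: l1_norm_def abs_mult sum_distrib_left)

lemma l1_norm_frag_extend_le:
  assumes "\<And>g. g \<in> Poly_Mapping.keys x \<Longrightarrow> l1_norm (f g) \<le> B"
  shows "l1_norm (frag_extend f x) \<le> l1_norm x * B"
proof -
  have sum_le: "l1_norm (sum h I) \<le> (\<Sum>i\<in>I. l1_norm (h i))" if "finite I" for h :: "'a \<Rightarrow> 'b \<Rightarrow>\<^sub>0 int" and I
    using that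
  proof (induction I rule: finite_induct)
    case (insert i I)
    then show ?case
      using l1_norm_add_le[of "h i" "sum h I"] by simp
  qed (simp add: l1_norm_def)
  have "l1_norm (frag_extend f x) \<le>
      (\<Sum>g\<in>Poly_Mapping.keys x. \<bar>Poly_Mapping.lookup x g\<bar> * l1_norm (f g))"
    using sum_le[of "Poly_Mapping.keys x" "\<lambda>g. frag_cmul (Poly_Mapping.lookup x g) (f g)"]
    by (simp add: frag_extend_def l1_norm_frag_cmul)
  also have "\<dots> \<le> (\<Sum>g\<in>Poly_Mapping.keys x. \<bar>Poly_Mapping.lookup x g\<bar> * B)"
    by (intro sum_mono mult_left_mono assms) auto
  finally show ?thesis
    by (simp add: l1_norm_def sum_distrib_right)
qed

text \<open>Left translation by \<open>g\<close> sends basis elements to basis elements, so it does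
  not increase the l1 norm; the triangle inequality over the support of \<open>x\<close> does the
  rest.\<close>

lemma l1_norm_mult_le: "l1_norm (x \<otimes>\<^bsub>int_group_ring G\<^esub> y) \<le> l1_norm x * l1_norm y"
proof -
  have "l1_norm (frag_extend (\<lambda>h. frag_of (g \<otimes>\<^bsub>G\<^esub> h)) y) \<le> l1_norm y" for g
    using l1_norm_frag_extend_le[of y "\<lambda>h. frag_of (g \<otimes>\<^bsub>G\<^esub> h)" 1] by simp
  then show ?thesis
    by (simp add: int_group_ring_def l1_norm_frag_extend_le)
qed

lemma l2_norm_sq_nonneg: "0 \<le> l2_norm_sq x"
  by (simp add: l2_norm_sq_def sum_nonneg)

lemma lookup_sq_le_l2_norm_sq: "(Poly_Mapping.lookup x g)\<^sup>2 \<le> l2_norm_sq x"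
proof (cases "g \<in> Poly_Mapping.keys x")
  case True
  then show ?thesis
    unfolding l2_norm_sq_def
    by (intro member_le_sum[of _ _ "\<lambda>g. (Poly_Mapping.lookup x g)\<^sup>2"]) auto
qed (simp add: in_keys_iff l2_norm_sq_nonneg)

lemma l2_norm_sq_le_l1_norm: "l2_norm_sq x \<le> (l1_norm x)\<^sup>2"
proof -
  have "(Poly_Mapping.lookup x g)\<^sup>2 \<le> \<bar>Poly_Mapping.lookup x g\<bar> * l1_norm x"
    if "g \<in> Poly_Mapping.keys x" for g
  proof -
    have "\<bar>Poly_Mapping.lookup x g\<bar> \<le> l1_norm x"
      unfolding l1_norm_def using that
      by (intro member_le_sum[of _ _ "\<lambda>g. \<bar>Poly_Mapping.lookup x g\<bar>"]) auto
    then have "\<bar>Poly_Mapping.lookup x g\<bar> * \<bar>Poly_Mapping.lookup x g\<bar> \<le>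
        \<bar>Poly_Mapping.lookup x g\<bar> * l1_norm x"
      by (intro mult_left_mono) auto
    then show ?thesis by (simp add: power2_eq_square)
  qed
  then have "l2_norm_sq x \<le> (\<Sum>g\<in>Poly_Mapping.keys x. \<bar>Poly_Mapping.lookup x g\<bar> * l1_norm x)"
    unfolding l2_norm_sq_def by (rule sum_mono)
  then show ?thesis
    by (simp add: l1_norm_def sum_distrib_right[symmetric] power2_eq_square)
qed

text \<open>Squares of nonzero integers are at least 1, so a sum of them equal to 1 has a single
  term, with coefficient 1 or -1.\<close>

lemma l2_norm_sq_eq_1:
  assumes "l2_norm_sq x = 1"
  obtains g where "x = frag_of g" | g where "x = - frag_of g"
proof -
  have "Poly_Mapping.keys x \<noteq> {}"
    using assms by (auto simp: l2_norm_sq_def)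
  then obtain g where g: "g \<in> Poly_Mapping.keys x" by blast
  have pos: "(Poly_Mapping.lookup x h)\<^sup>2 \<ge> 1" if "h \<in> Poly_Mapping.keys x" for h
    using that by (auto simp: in_keys_iff int_one_le_iff_zero_less)
  have sum: "(Poly_Mapping.lookup x g)\<^sup>2 +
      (\<Sum>h\<in>Poly_Mapping.keys x - {g}. (Poly_Mapping.lookup x h)\<^sup>2) = 1"
    using assms g by (simp add: l2_norm_sq_def sum.remove)
  have ge: "(\<Sum>h\<in>Poly_Mapping.keys x - {g}. (Poly_Mapping.lookup x h)\<^sup>2) \<ge> 0"
    by (simp add: sum_nonneg)
  have "(\<Sum>h\<in>Poly_Mapping.keys x - {g}. (Poly_Mapping.lookup x h)\<^sup>2) = 0"
    using sum ge pos[OF g] by linarith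
  then have zero: "Poly_Mapping.lookup x h = 0" if "h \<noteq> g" for h
    using that by (auto simp: sum_nonneg_eq_0_iff in_keys_iff)
  have "(Poly_Mapping.lookup x g)\<^sup>2 = 1"
    using sum ge pos[OF g] by linarith
  then consider "Poly_Mapping.lookup x g = 1" | "Poly_Mapping.lookup x g = -1"
    by (auto simp: power2_eq_1_iff)
  then show ?thesis
  proof cases
    case 1
    then have "x = frag_of g" by (intro poly_mapping_eqI) (simp add: zero)
    then show ?thesis by (rule that)
  next
    case 2
    then have "x = - frag_of g" by (intro poly_mapping_eqI) (simp add: zero)
    then show ?thesis by (rule that)
  qed
qed

section \<open>Products and the involution\<close>

lemma int_group_ring_carrier_iff:
  "x \<in> carrier (int_group_ring G) \<longleftrightarrow> Poly_Mapping.keys x \<subseteq> carrier G"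
  by (simp add: int_group_ring_def)

lemma int_group_ring_mult:
  "x \<otimes>\<^bsub>int_group_ring G\<^esub> y = frag_extend (\<lambda>g. frag_extend (\<lambda>h. frag_of (g \<otimes>\<^bsub>G\<^esub> h)) y) x"
  by (simp add: int_group_ring_def)

lemma int_group_ring_one: "\<one>\<^bsub>int_group_ring G\<^esub> = frag_of \<one>\<^bsub>G\<^esub>"
  by (simp add: int_group_ring_def)

lemma int_group_ring_mult_frag_of:
  "frag_of g \<otimes>\<^bsub>int_group_ring G\<^esub> frag_of h = frag_of (g \<otimes>\<^bsub>G\<^esub> h)"
  by (simp add: int_group_ring_mult)

text \<open>Bilinearity is phrased with differences because \<open>frag_induction\<close> builds
  elements from 0 and basis elements by subtraction.\<close>

lemma int_group_ring_mult_diff: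
  "(x - y) \<otimes>\<^bsub>int_group_ring G\<^esub> z = x \<otimes>\<^bsub>int_group_ring G\<^esub> z - y \<otimes>\<^bsub>int_group_ring G\<^esub> z"
  "z \<otimes>\<^bsub>int_group_ring G\<^esub> (x - y) = z \<otimes>\<^bsub>int_group_ring G\<^esub> x - z \<otimes>\<^bsub>int_group_ring G\<^esub> y"
proof -
  show "(x - y) \<otimes>\<^bsub>int_group_ring G\<^esub> z = x \<otimes>\<^bsub>int_group_ring G\<^esub> z - y \<otimes>\<^bsub>int_group_ring G\<^esub> z"
    by (simp add: int_group_ring_mult frag_extend_diff)
  show "z \<otimes>\<^bsub>int_group_ring G\<^esub> (x - y) = z \<otimes>\<^bsub>int_group_ring G\<^esub> x - z \<otimes>\<^bsub>int_group_ring G\<^esub> y"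
    by (simp add: int_group_ring_mult eq_diff_eq frag_extend_diff flip: frag_extend_plus_fun)
qed

lemma int_group_ring_mult_0:
  "0 \<otimes>\<^bsub>int_group_ring G\<^esub> x = 0" "x \<otimes>\<^bsub>int_group_ring G\<^esub> 0 = 0"
  by (simp_all add: int_group_ring_mult frag_extend_eq_0)

context group
begin

lemma frag_star_frag_of [simp]: "frag_star G (frag_of g) = frag_of (inv g)"
  by (simp add: frag_star_def)

lemma frag_star_0 [simp]: "frag_star G 0 = 0"
  by (simp add: frag_star_def)

lemma frag_star_diff: "frag_star G (x - y) = frag_star G x - frag_star G y"
  by (simp add: frag_star_def frag_extend_diff)

lemma frag_star_closed:
  assumes "x \<in> carrier (int_group_ring G)"
  shows "frag_star G x \<in> carrier (int_group_ring G)"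
  using assms
  by (auto simp: frag_star_def int_group_ring_carrier_iff subset_iff keys_frag_of
      dest!: subsetD[OF keys_frag_extend])

lemma frag_star_frag_star:
  assumes "x \<in> carrier (int_group_ring G)"
  shows "frag_star G (frag_star G x) = x"
  using assms unfolding int_group_ring_carrier_iff
  by (induction x rule: frag_induction) (auto simp: frag_star_diff)

lemma frag_star_mult:
  assumes x: "x \<in> carrier (int_group_ring G)" and y: "y \<in> carrier (int_group_ring G)"
  shows "frag_star G (x \<otimes>\<^bsub>int_group_ring G\<^esub> y) =
    frag_star G y \<otimes>\<^bsub>int_group_ring G\<^esub> frag_star G x"
  using x unfolding int_group_ring_carrier_iff
proof (induction x rule: frag_induction)
  case (one g)
  show ?case
    using y unfolding int_group_ring_carrier_iff
    \<comment> \<open>A second induction reduces to two basis elements, where the claim is the rule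
      for inverting a product in \<open>G\<close>.\<close>
    by (induction y rule: frag_induction)
      (use one in \<open>auto simp: int_group_ring_mult_0 int_group_ring_mult_frag_of
        int_group_ring_mult_diff frag_star_diff inv_mult_group\<close>)
qed (auto simp: int_group_ring_mult_0 int_group_ring_mult_diff frag_star_diff)

text \<open>Expanding the product, the pair \<open>g\<close>, \<open>h\<close> contributes to the
  coefficient at the identity only when \<open>g = h\<close>, which leaves the sum of
  squares.\<close>

lemma lookup_one_mult_frag_star:
  assumes x: "x \<in> carrier (int_group_ring G)"
  shows "Poly_Mapping.lookup (x \<otimes>\<^bsub>int_group_ring G\<^esub> frag_star G x) \<one> = l2_norm_sq x"
proof -
  have inv: "\<one> = g \<otimes> inv h \<longleftrightarrow> g = h"
    if "g \<in> Poly_Mapping.keys x" "h \<in> Poly_Mapping.keys x" for g h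
    using that x inv_solve_right[of \<one> g h] by (auto simp: int_group_ring_carrier_iff subset_iff)
  have "Poly_Mapping.lookup (x \<otimes>\<^bsub>int_group_ring G\<^esub> frag_star G x) \<one> =
      (\<Sum>g\<in>Poly_Mapping.keys x. Poly_Mapping.lookup x g *
        (\<Sum>h\<in>Poly_Mapping.keys x. Poly_Mapping.lookup x h * (if \<one> = g \<otimes> inv h then 1 else 0)))"
    by (simp add: int_group_ring_mult frag_star_def frag_extend_frag_extend)
      (simp add: frag_extend_def lookup_sum)
  also have "\<dots> = (\<Sum>g\<in>Poly_Mapping.keys x. Poly_Mapping.lookup x g *
        (\<Sum>h\<in>Poly_Mapping.keys x. if g = h then Poly_Mapping.lookup x h else 0))"
    by (intro sum.cong refl arg_cong2[of _ _ _ _ "(*)"]) (simp add: inv)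
  also have "\<dots> = l2_norm_sq x"
    by (simp add: l2_norm_sq_def power2_eq_square)
  finally show ?thesis .
qed

text \<open>With \<open>w = z z\<^sup>*\<close>, normality gives \<open>w w\<^sup>* = z\<^sup>2 (z\<^sup>2)\<^sup>*\<close>, so the right-hand side is \<open>\<parallel>w\<parallel>\<^sub>2\<^sup>2\<close>, while
  \<open>\<parallel>z\<parallel>\<^sub>2\<^sup>2\<close> is the coefficient of \<open>w\<close> at 1.\<close>
lemma l2_norm_sq_normal_square:
  assumes z: "z \<in> carrier (int_group_ring G)"
    and comm: "z \<otimes>\<^bsub>int_group_ring G\<^esub> frag_star G z = frag_star G z \<otimes>\<^bsub>int_group_ring G\<^esub> z"
  shows "(l2_norm_sq z)\<^sup>2 \<le> l2_norm_sq (z \<otimes>\<^bsub>int_group_ring G\<^esub> z)"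
proof -
  let ?R = "int_group_ring G"
  interpret R: ring ?R by (rule ring_int_group_ring) (rule is_group)
  let ?s = "frag_star G z"
  let ?w = "z \<otimes>\<^bsub>?R\<^esub> ?s"
  have s: "?s \<in> carrier ?R" by (rule frag_star_closed[OF z])
  have "?w \<otimes>\<^bsub>?R\<^esub> frag_star G ?w = z \<otimes>\<^bsub>?R\<^esub> (?s \<otimes>\<^bsub>?R\<^esub> z) \<otimes>\<^bsub>?R\<^esub> ?s"
    using z s by (simp add: frag_star_mult frag_star_frag_star R.m_assoc)
  also have "?s \<otimes>\<^bsub>?R\<^esub> z = z \<otimes>\<^bsub>?R\<^esub> ?s" by (rule comm[symmetric])
  also have "z \<otimes>\<^bsub>?R\<^esub> (z \<otimes>\<^bsub>?R\<^esub> ?s) \<otimes>\<^bsub>?R\<^esub> ?s = (z \<otimes>\<^bsub>?R\<^esub> z) \<otimes>\<^bsub>?R\<^esub> frag_star G (z \<otimes>\<^bsub>?R\<^esub> z)"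
    using z s by (simp add: frag_star_mult R.m_assoc)
  finally have "l2_norm_sq ?w = l2_norm_sq (z \<otimes>\<^bsub>?R\<^esub> z)"
    using z s by (metis lookup_one_mult_frag_star R.m_closed)
  with lookup_sq_le_l2_norm_sq[of ?w \<one>] show ?thesis
    using lookup_one_mult_frag_star[OF z] by simp
qed

subsection \<open>Central units\<close>

lemma frag_of_unit:
  assumes "g \<in> carrier G"
  shows "frag_of g \<in> carrier (int_group_ring_units G)"
proof -
  have "frag_of h \<in> carrier (int_group_ring G)" if "h \<in> carrier G" for h
    using that by (simp add: int_group_ring_carrier_iff keys_frag_of)
  then show ?thesis
    using assms unfolding units_of_carrier Units_def
    by (auto intro!: bexI[of _ "frag_of (inv g)"]
        simp: int_group_ring_mult_frag_of int_group_ring_one)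
qed

lemma frag_of_nat_pow:
  "frag_of g [^]\<^bsub>int_group_ring_units G\<^esub> (k::nat) = frag_of (g [^] k)"
  by (induction k) (simp_all add: units_of_one units_of_mult int_group_ring_one int_group_ring_mult_frag_of)

lemma commute_frag_of_imp_commute:
  assumes "\<And>g. g \<in> carrier G \<Longrightarrow>
      u \<otimes>\<^bsub>int_group_ring G\<^esub> frag_of g = frag_of g \<otimes>\<^bsub>int_group_ring G\<^esub> u"
    and x: "x \<in> carrier (int_group_ring G)"
  shows "u \<otimes>\<^bsub>int_group_ring G\<^esub> x = x \<otimes>\<^bsub>int_group_ring G\<^esub> u"
  using x unfolding int_group_ring_carrier_iff
  by (induction x rule: frag_induction)
    (auto simp: int_group_ring_mult_0 int_group_ring_mult_diff assms(1))

text \<open>Group elements are units and span the ring, so a central unit is central in the whole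
  ring. In particular it commutes with its image under \<open>frag_star\<close>.\<close>

lemma central_unit_commute:
  assumes "c \<in> group_center (int_group_ring_units G)" "x \<in> carrier (int_group_ring G)"
  shows "c \<otimes>\<^bsub>int_group_ring G\<^esub> x = x \<otimes>\<^bsub>int_group_ring G\<^esub> c"
proof (rule commute_frag_of_imp_commute[OF _ assms(2)])
  fix g assume "g \<in> carrier G"
  then show "c \<otimes>\<^bsub>int_group_ring G\<^esub> frag_of g = frag_of g \<otimes>\<^bsub>int_group_ring G\<^esub> c"
    using assms(1) frag_of_unit unfolding group_center_def units_of_mult by blast
qed

text \<open>Squaring a central unit at least squares its squared l2 norm. Starting from 2 or more,
  repeated squaring would exceed every bound, although the l1 norm of the powers stays below
  \<open>B\<close>.\<close>

lemma l2_norm_sq_central_unit: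
  assumes c: "c \<in> group_center (int_group_ring_units G)"
    and bound: "\<And>k::nat. l1_norm (c [^]\<^bsub>int_group_ring_units G\<^esub> k) \<le> B"
  shows "l2_norm_sq c = 1"
proof (rule ccontr)
  let ?R = "int_group_ring G" and ?U = "int_group_ring_units G"
  interpret R: ring ?R by (rule ring_int_group_ring) (rule is_group)
  interpret U: group ?U by (rule group_int_group_ring_units) (rule is_group)
  interpret Z: normal "group_center ?U" ?U by (rule normal_group_center) (rule U.is_group)
  assume ne: "l2_norm_sq c \<noteq> 1"
  have cU: "c \<in> Units ?R"
    using Z.mem_carrier[OF c] by (simp add: units_of_carrier)
  have "c \<noteq> 0"
    using R.Units_r_inv[OF cU] by (auto simp: int_group_ring_mult_0 int_group_ring_one)
  then obtain g where "Poly_Mapping.lookup c g \<noteq> 0"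
    by (auto simp: poly_mapping_eq_iff fun_eq_iff)
  then have "0 < l2_norm_sq c"
    using lookup_sq_le_l2_norm_sq[of c g] zero_less_power2[of "Poly_Mapping.lookup c g"]
    by linarith
  with ne have ge2: "l2_norm_sq c \<ge> 2" by simp
  \<comment> \<open>Linear growth in \<open>j\<close> already contradicts the bound, and its
    inductive step only needs \<open>N * N \<ge> 2 * N\<close> for \<open>N \<ge> 2\<close>.\<close>
  have growth: "l2_norm_sq (c [^]\<^bsub>?U\<^esub> ((2::nat) ^ j)) \<ge> int j + 2" for j
  proof (induction j)
    case 0
    show ?case using ge2 cU by (simp add: units_of_carrier)
  next
    case (Suc j)
    let ?d = "c [^]\<^bsub>?U\<^esub> ((2::nat) ^ j)"
    have "c [^]\<^bsub>?U\<^esub> (k::nat) \<in> group_center ?U" for k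
      by (induction k) (use c in auto)
    then have d: "?d \<in> group_center ?U" .
    then have dR: "?d \<in> carrier ?R"
      using Z.mem_carrier[OF d] R.Units_closed by (simp add: units_of_carrier)
    have "int (Suc j) + 2 \<le> 2 * l2_norm_sq ?d"
      using Suc by simp
    also have "\<dots> \<le> (l2_norm_sq ?d)\<^sup>2"
      using Suc by (simp add: power2_eq_square mult_right_mono)
    also have "\<dots> \<le> l2_norm_sq (?d \<otimes>\<^bsub>?R\<^esub> ?d)"
      by (intro l2_norm_sq_normal_square dR central_unit_commute[OF d] frag_star_closed)
    also have "?d \<otimes>\<^bsub>?R\<^esub> ?d = ?d \<otimes>\<^bsub>?U\<^esub> ?d"
      by (simp add: units_of_mult)
    also have "\<dots> = c [^]\<^bsub>?U\<^esub> ((2::nat) ^ Suc j)"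
      using U.nat_pow_mult[OF Z.mem_carrier[OF c]] by (simp add: mult_2)
    finally show ?case .
  qed
  have "int j + 2 \<le> B\<^sup>2" for j
  proof -
    have "int j + 2 \<le> (l1_norm (c [^]\<^bsub>?U\<^esub> ((2::nat) ^ j)))\<^sup>2"
      using growth[of j] l2_norm_sq_le_l1_norm by (rule order_trans)
    also have "\<dots> \<le> B\<^sup>2"
      by (intro power_mono bound l1_norm_nonneg)
    finally show ?thesis .
  qed
  \<comment> \<open>With \<open>j\<close> equal to the square of \<open>B\<close>, the inequality
    exceeds its own bound by 2.\<close>
  from this[of "nat (B\<^sup>2)"] show False by simp
qed

text \<open>A norm of 1 leaves only a signed group element; squaring removes the sign, at the price
  of a factor 2 in the final exponent.\<close>

lemma central_unit_square_of_group_center: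
  assumes c: "c \<in> group_center (int_group_ring_units G)" and sq: "l2_norm_sq c = 1"
  obtains h where "h \<in> group_center G"
    "c \<otimes>\<^bsub>int_group_ring_units G\<^esub> c = frag_of (h \<otimes> h)"
proof -
  let ?R = "int_group_ring G" and ?U = "int_group_ring_units G"
  interpret R: ring ?R by (rule ring_int_group_ring) (rule is_group)
  obtain h where h: "c = frag_of h \<or> c = - frag_of h"
    using l2_norm_sq_eq_1[OF sq] by metis
  have cR: "c \<in> carrier ?R"
    using c R.Units_closed by (auto simp: group_center_def units_of_carrier)
  then have hG: "h \<in> carrier G"
    using h by (auto simp: int_group_ring_carrier_iff keys_frag_of)
  have minus: "(- x) \<otimes>\<^bsub>?R\<^esub> y = - (x \<otimes>\<^bsub>?R\<^esub> y)" "y \<otimes>\<^bsub>?R\<^esub> (- x) = - (y \<otimes>\<^bsub>?R\<^esub> x)" for x y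
    using int_group_ring_mult_diff(1)[of G 0 x y] int_group_ring_mult_diff(2)[of G y 0 x]
    by (simp_all add: int_group_ring_mult_0)
  have "h \<otimes> g = g \<otimes> h" if "g \<in> carrier G" for g
    using h central_unit_commute[OF c, of "frag_of g"] that
    by (auto simp: int_group_ring_carrier_iff keys_frag_of int_group_ring_mult_frag_of minus frag_of_eq)
  then have "h \<in> group_center G"
    using hG by (simp add: group_center_def)
  moreover have "c \<otimes>\<^bsub>?U\<^esub> c = frag_of (h \<otimes> h)"
    using h by (auto simp: units_of_mult minus int_group_ring_mult_frag_of)
  ultimately show ?thesis by (rule that)
qed

text \<open>The k-th power of \<open>c\<close> is the commutator of the k-th power of
  \<open>g\<close> with \<open>u\<close>. Group elements have l1 norm 1, so submultiplicativity
  gives a bound free of \<open>k\<close>.\<close>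

lemma l1_norm_central_commutator_pow_le:
  assumes c: "c \<in> group_center (int_group_ring_units G)"
    and u: "u \<in> carrier (int_group_ring_units G)" and g: "g \<in> carrier G"
    and eq: "frag_of g \<otimes>\<^bsub>int_group_ring_units G\<^esub> u =
      c \<otimes>\<^bsub>int_group_ring_units G\<^esub> u \<otimes>\<^bsub>int_group_ring_units G\<^esub> frag_of g"
  shows "l1_norm (c [^]\<^bsub>int_group_ring_units G\<^esub> (k::nat)) \<le>
    l1_norm u * l1_norm (inv\<^bsub>int_group_ring_units G\<^esub> u)"
proof -
  let ?U = "int_group_ring_units G" and ?R = "int_group_ring G"
  interpret U: group ?U by (rule group_int_group_ring_units) (rule is_group)
  \<comment> \<open>The inverse is written as a basis element so that its l1 norm is visibly
    1.\<close>
  let ?y = "frag_of (g [^] k)" and ?y' = "frag_of (inv (g [^] k))"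
  have y: "?y \<in> carrier ?U" and y': "?y' \<in> carrier ?U"
    using g by (auto intro: frag_of_unit)
  have ck: "c [^]\<^bsub>?U\<^esub> k \<in> carrier ?U"
    using c by (simp add: group_center_def)
  have yy': "?y \<otimes>\<^bsub>?U\<^esub> ?y' = \<one>\<^bsub>?U\<^esub>"
    using g by (simp add: units_of_mult units_of_one int_group_ring_mult_frag_of int_group_ring_one)
  have "?y \<otimes>\<^bsub>?U\<^esub> u = c [^]\<^bsub>?U\<^esub> k \<otimes>\<^bsub>?U\<^esub> u \<otimes>\<^bsub>?U\<^esub> ?y"
    using U.commutator_nat_pow_left[OF c u frag_of_unit[OF g] eq] by (simp add: frag_of_nat_pow)
  then have "?y \<otimes>\<^bsub>?U\<^esub> u \<otimes>\<^bsub>?U\<^esub> ?y' \<otimes>\<^bsub>?U\<^esub> inv\<^bsub>?U\<^esub> u =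
      c [^]\<^bsub>?U\<^esub> k \<otimes>\<^bsub>?U\<^esub> u \<otimes>\<^bsub>?U\<^esub> (?y \<otimes>\<^bsub>?U\<^esub> ?y') \<otimes>\<^bsub>?U\<^esub> inv\<^bsub>?U\<^esub> u"
    using y y' ck u by (simp add: U.m_assoc)
  also have "\<dots> = c [^]\<^bsub>?U\<^esub> k"
    unfolding yy' using ck u by (simp add: U.m_assoc)
  finally have "c [^]\<^bsub>?U\<^esub> k = ?y \<otimes>\<^bsub>?R\<^esub> u \<otimes>\<^bsub>?R\<^esub> ?y' \<otimes>\<^bsub>?R\<^esub> inv\<^bsub>?U\<^esub> u"
    by (simp add: units_of_mult)
  also have "l1_norm \<dots> \<le> l1_norm (?y \<otimes>\<^bsub>?R\<^esub> u \<otimes>\<^bsub>?R\<^esub> ?y') * l1_norm (inv\<^bsub>?U\<^esub> u)"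
    by (rule l1_norm_mult_le)
  also have "\<dots> \<le> l1_norm u * l1_norm (inv\<^bsub>?U\<^esub> u)"
    using l1_norm_mult_le[of G "?y \<otimes>\<^bsub>?R\<^esub> u" ?y'] l1_norm_mult_le[of G ?y u]
    by (intro mult_right_mono l1_norm_nonneg) simp
  finally show ?thesis .
qed

section \<open>Powers of second central units\<close>

lemma second_central_unit_commutator:
  assumes u: "u \<in> upper_central (int_group_ring_units G) (Suc (Suc 0))" and g: "g \<in> carrier G"
  obtains c where "c \<in> group_center (int_group_ring_units G)"
    "frag_of g \<otimes>\<^bsub>int_group_ring_units G\<^esub> u =
      c \<otimes>\<^bsub>int_group_ring_units G\<^esub> u \<otimes>\<^bsub>int_group_ring_units G\<^esub> frag_of g"
proof -
  interpret U: group "int_group_ring_units G"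
    by (rule group_int_group_ring_units) (rule is_group)
  let ?c = "frag_of g \<otimes>\<^bsub>int_group_ring_units G\<^esub> u \<otimes>\<^bsub>int_group_ring_units G\<^esub>
    inv\<^bsub>int_group_ring_units G\<^esub> frag_of g \<otimes>\<^bsub>int_group_ring_units G\<^esub> inv\<^bsub>int_group_ring_units G\<^esub> u"
  show ?thesis
  proof (rule that)
    show "?c \<in> group_center (int_group_ring_units G)"
      using u frag_of_unit[OF g] unfolding U.upper_central_1[symmetric] U.upper_central_Suc_iff[of u]
      by blast
    show "frag_of g \<otimes>\<^bsub>int_group_ring_units G\<^esub> u =
        ?c \<otimes>\<^bsub>int_group_ring_units G\<^esub> u \<otimes>\<^bsub>int_group_ring_units G\<^esub> frag_of g"
      by (rule U.commutator_mult_eq[symmetric, OF U.upper_central_carrier[OF u] frag_of_unit[OF g]])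
  qed
qed

lemma central_unit_if_commute_frag_of:
  assumes u: "u \<in> carrier (int_group_ring_units G)"
    and comm: "\<And>g. g \<in> carrier G \<Longrightarrow>
      frag_of g \<otimes>\<^bsub>int_group_ring_units G\<^esub> u = u \<otimes>\<^bsub>int_group_ring_units G\<^esub> frag_of g"
  shows "u \<in> group_center (int_group_ring_units G)"
proof -
  interpret R: ring "int_group_ring G" by (rule ring_int_group_ring) (rule is_group)
  show ?thesis
    using u commute_frag_of_imp_commute[of u] comm[symmetric] R.Units_closed
    unfolding group_center_def units_of_mult units_of_carrier by blast
qed

text \<open>The point is uniformity: \<open>c\<close> varies with \<open>u\<close> and the group
  element, but the exponent that kills it depends on \<open>G\<close> alone.\<close>

lemma second_central_unit_pow_central:
  assumes "finite_exponent (G\<lparr>carrier := group_center G\<rparr>) \<or> bounded_torsion_generated G"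
  obtains m :: nat where "m \<ge> 1"
    "\<And>u. u \<in> upper_central (int_group_ring_units G) (Suc (Suc 0)) \<Longrightarrow>
      u [^]\<^bsub>int_group_ring_units G\<^esub> m \<in> group_center (int_group_ring_units G)"
  using assms
proof
  let ?U = "int_group_ring_units G"
  interpret U: group ?U by (rule group_int_group_ring_units) (rule is_group)
  assume "finite_exponent (G\<lparr>carrier := group_center G\<rparr>)"
  then obtain n :: nat where n: "n \<ge> 1" and pow: "\<And>h. h \<in> group_center G \<Longrightarrow> h [^] n = \<one>"
    unfolding finite_exponent_def nat_pow_consistent[symmetric] by auto
  interpret Z: normal "group_center G" G by (rule normal_group_center) (rule is_group)
  have "u [^]\<^bsub>?U\<^esub> (2 * n) \<in> group_center ?U" if u: "u \<in> upper_central ?U (Suc (Suc 0))" for u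
  proof (rule central_unit_if_commute_frag_of)
    have uU: "u \<in> carrier ?U" by (rule U.upper_central_carrier[OF u])
    then show "u [^]\<^bsub>?U\<^esub> (2 * n) \<in> carrier ?U" by simp
    fix g assume g: "g \<in> carrier G"
    obtain c where c: "c \<in> group_center ?U"
      and eq: "frag_of g \<otimes>\<^bsub>?U\<^esub> u = c \<otimes>\<^bsub>?U\<^esub> u \<otimes>\<^bsub>?U\<^esub> frag_of g"
      by (rule second_central_unit_commutator[OF u g])
    have cU: "c \<in> carrier ?U" using c by (simp add: group_center_def)
    have "l2_norm_sq c = 1"
      by (rule l2_norm_sq_central_unit[OF c l1_norm_central_commutator_pow_le[OF c uU g eq]])
    then obtain h where h: "h \<in> group_center G" "c \<otimes>\<^bsub>?U\<^esub> c = frag_of (h \<otimes> h)"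
      by (rule central_unit_square_of_group_center[OF c])
    \<comment> \<open>The factor 2 absorbs the sign of \<open>c\<close>; the factor \<open>n\<close>
      kills \<open>h \<otimes> h\<close>, which lies in the center of \<open>G\<close>.\<close>
    have "c [^]\<^bsub>?U\<^esub> (2 * n) = (c \<otimes>\<^bsub>?U\<^esub> c) [^]\<^bsub>?U\<^esub> n"
      using cU U.nat_pow_pow[of c 2 n] by (simp add: numeral_2_eq_2)
    also have "\<dots> = \<one>\<^bsub>?U\<^esub>"
      using h pow[of "h \<otimes> h"] by (simp add: frag_of_nat_pow units_of_one int_group_ring_one)
    finally show "frag_of g \<otimes>\<^bsub>?U\<^esub> u [^]\<^bsub>?U\<^esub> (2 * n) = u [^]\<^bsub>?U\<^esub> (2 * n) \<otimes>\<^bsub>?U\<^esub> frag_of g"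
      by (rule U.commute_pow_if_commutator_pow_eq_one[OF c uU frag_of_unit[OF g] eq])
  qed
  then show thesis using n by (intro that[of "2 * n"]) auto
next
  let ?U = "int_group_ring_units G"
  interpret U: group ?U by (rule group_int_group_ring_units) (rule is_group)
  assume "bounded_torsion_generated G"
  then obtain S and m :: nat where S: "S \<subseteq> carrier G" "generate G S = carrier G"
    and m: "m \<ge> 1" and pow: "\<And>s. s \<in> S \<Longrightarrow> s [^] m = \<one>"
    unfolding bounded_torsion_generated_def by blast
  have "u [^]\<^bsub>?U\<^esub> m \<in> group_center ?U" if u: "u \<in> upper_central ?U (Suc (Suc 0))" for u
  proof (rule central_unit_if_commute_frag_of)
    have uU: "u \<in> carrier ?U" by (rule U.upper_central_carrier[OF u])
    then show umU: "u [^]\<^bsub>?U\<^esub> m \<in> carrier ?U" by simp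
    have torsion: "frag_of s \<otimes>\<^bsub>?U\<^esub> u [^]\<^bsub>?U\<^esub> m = u [^]\<^bsub>?U\<^esub> m \<otimes>\<^bsub>?U\<^esub> frag_of s"
      if s: "s \<in> carrier G" "s [^] m = \<one>" for s
    proof -
      obtain c where c: "c \<in> group_center ?U"
        and eq: "frag_of s \<otimes>\<^bsub>?U\<^esub> u = c \<otimes>\<^bsub>?U\<^esub> u \<otimes>\<^bsub>?U\<^esub> frag_of s"
        by (rule second_central_unit_commutator[OF u s(1)])
      have cU: "c \<in> carrier ?U" using c by (simp add: group_center_def)
      have "frag_of s [^]\<^bsub>?U\<^esub> m = \<one>\<^bsub>?U\<^esub>"
        using s by (simp add: frag_of_nat_pow units_of_one int_group_ring_one)
      \<comment> \<open>The m-th power of \<open>s\<close> is trivial, so moving it past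
        \<open>u\<close> leaves only the m-th power of \<open>c\<close>, and cancelling
        \<open>u\<close> shows that this is trivial.\<close>
      then have "u = c [^]\<^bsub>?U\<^esub> m \<otimes>\<^bsub>?U\<^esub> u"
        using U.commutator_nat_pow_left[OF c uU frag_of_unit[OF s(1)] eq, of m] uU cU by simp
      then have "c [^]\<^bsub>?U\<^esub> m = \<one>\<^bsub>?U\<^esub>"
        using uU cU by (metis U.l_cancel_one' U.nat_pow_closed U.r_cancel_one')
      then show ?thesis
        by (rule U.commute_pow_if_commutator_pow_eq_one[OF c uU frag_of_unit[OF s(1)] eq])
    qed
    fix g assume "g \<in> carrier G"
    then have "g \<in> generate G S" by (simp add: S)
    then show "frag_of g \<otimes>\<^bsub>?U\<^esub> u [^]\<^bsub>?U\<^esub> m = u [^]\<^bsub>?U\<^esub> m \<otimes>\<^bsub>?U\<^esub> frag_of g"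
    proof (induction g rule: generate.induct)
      case one
      show ?case by (rule torsion) simp_all
    next
      case (incl s)
      then show ?case using S pow by (intro torsion) auto
    next
      case (inv s)
      \<comment> \<open>The inverse of a generator has trivial m-th power too, so
        \<open>torsion\<close> covers it directly.\<close>
      then show ?case using S pow by (intro torsion) (auto simp: nat_pow_inv)
    next
      case (eng g h)
      then have gh: "frag_of g \<in> carrier ?U" "frag_of h \<in> carrier ?U"
        using S by (auto intro: frag_of_unit)
      have "frag_of (g \<otimes> h) = frag_of g \<otimes>\<^bsub>?U\<^esub> frag_of h"
        by (simp add: units_of_mult int_group_ring_mult_frag_of)
      then show ?case
        using eng.IH gh umU by (metis U.m_assoc)
    qed
  qed
  then show thesis using m by (intro that[of m]) auto
qed

end

section \<open>One exponent for all higher factors\<close>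

theorem theorem15:
  fixes G :: "('a, 'b) monoid_scheme"
  assumes "group G"
    and "finite_exponent (G\<lparr>carrier := group_center G\<rparr>) \<or> bounded_torsion_generated G"
  shows "\<forall>i\<ge>2. finite_exponent
    ((int_group_ring_units G)\<lparr>carrier := upper_central (int_group_ring_units G) i\<rparr>
      Mod upper_central (int_group_ring_units G) (i - 1))"
proof (intro allI impI)
  let ?U = "int_group_ring_units G"
  interpret U: group ?U by (rule group_int_group_ring_units) (rule assms(1))
  obtain m :: nat where m: "m \<ge> 1"
    and base: "\<And>u. u \<in> upper_central ?U (Suc (Suc 0)) \<Longrightarrow> u [^]\<^bsub>?U\<^esub> m \<in> group_center ?U"
    using group.second_central_unit_pow_central[OF assms] by blast
  \<comment> \<open>The same \<open>m\<close> serves every factor: the base case is Z_2 over Z_1,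
    and \<open>upper_central_pow_Suc\<close> lifts it one level at a time.\<close>
  have pow: "u [^]\<^bsub>?U\<^esub> m \<in> upper_central ?U (Suc n)" if "u \<in> upper_central ?U (Suc (Suc n))" for n u
    using that
  proof (induction n arbitrary: u)
    case 0
    then show ?case using base unfolding U.upper_central_1 by blast
  next
    case (Suc n)
    show ?case by (rule U.upper_central_pow_Suc[OF Suc])
  qed
  fix i :: nat
  assume "i \<ge> 2"
  then obtain n where i: "i = Suc (Suc n)"
    by (metis Suc_le_D numeral_2_eq_2 Suc_le_mono)
  have normal: "upper_central ?U k \<lhd> ?U" for k
    by (rule normal_upper_central) (rule U.is_group)
  show "finite_exponent (?U\<lparr>carrier := upper_central ?U i\<rparr> Mod upper_central ?U (i - 1))"
    unfolding i diff_Suc_1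
    by (rule U.finite_exponent_quotient[OF normal_imp_subgroup[OF normal] normal
          U.upper_central_le_Suc m pow])
qed

end
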